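(* Let $d\ge 2$. For each $n$ there exists a constant $C=C(d,n)$ such that for every $T>0$, $$\sum_{w \in \mathcal{K}_{2n} \setminus (\mathcal{S}_{2n} \cup \mathcal{W}_{2n})} C^{w}(\phi^{M}(T)) < \frac{C\, T^{n}}{M^{2}}$$ for all sufficiently large $M$.
   Context: Let $(e_1,\dots,e_d)$ be the standard basis of $\mathbb{R}^d$ and $B_t=\sum_{j=1}^d B_t^j e_j$, where $B^1,\dots,B^d$ are independent standard one-dimensional Brownian motions started at $0$. A word of length $n$ is $w=e_{i_1}\cdots e_{i_n}$ with $1\le i_1,\dots,i_n\le d$; $|w|$ is its length, $N_i(w)$ the number of occurrences of $e_i$ in $w$, and $*$ denotes concatenation of words. $B^{(M)}$ ($M\ge1$ an integer) is the piecewise linear path on $[0,T]$ that coincides with $B$ at the points $kT/M$, $k=0,\dots,M$, and is linear on each $[kT/M,(k+1)T/M]$. For $w=e_{i_1}\cdots e_{i_n}$, $C^w(\phi^M(T))$ denotes the coefficient of $w$ in the expected signature $\phi^M(T)$ of $B^{(M)}$ over $[0,T]$, i.e. the expectation of the iterated integral $\int_{0<u_1<\cdots<u_n<T} d(B^{(M)})^{i_1}_{u_1}\cdots d(B^{(M)})^{i_n}_{u_n}$ (equal to $1$ for the empty word). Sets of words: $\mathcal{S}_{2n}=\{e_{i_1}^2\cdots e_{i_n}^2 : 1\le i_1,\dots,i_n\le d\}$; $\mathcal{K}_{2n}=\{w : |w|=2n,\ N_i(w)\text{ is even for all } i\}$; $\mathcal{E}=\{e_ie_je_ie_j,\ e_ie_je_je_i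 : 1\le i,j\le d,\ i\ne j\}$; for $0\le k\le n-2$, $\mathcal{W}_{2n}^k=\{v*v'*v'' : v\in\mathcal{S}_{2k},\ v'\in\mathcal{E},\ v''\in\mathcal{S}_{2n-4-2k}\}$; and $\mathcal{W}_{2n}=\bigcup_{k=0}^{n-2}\mathcal{W}_{2n}^k$ (empty if $n<2$). *)

theory Defs
  imports "HOL-Probability.Probability"
begin

locale standard_brownian_motion = prob_space P for P :: "'w measure" +
  fixes W :: "real \<Rightarrow> 'w \<Rightarrow> real"
  assumes random_variable_W: "\<And>t. 0 \<le> t \<Longrightarrow> random_variable borel (W t)"
    and start_at_0: "AE \<omega> in P. W 0 \<omega> = 0"
    and gaussian_increments: "\<And>s t. 0 \<le> s \<Longrightarrow> s < t \<Longrightarrow>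
          distributed P lborel (\<lambda>\<omega>. W t \<omega> - W s \<omega>) (normal_density 0 (sqrt (t - s)))"
    and indep_increments: "\<And>(t :: nat \<Rightarrow> real) m. 0 \<le> t 0 \<Longrightarrow> mono t \<Longrightarrow>
          indep_vars (\<lambda>_. borel) (\<lambda>k \<omega>. W (t (Suc k)) \<omega> - W (t k) \<omega>) {..<m}"
    and continuous_paths: "AE \<omega> in P. continuous_on {0..} (\<lambda>t. W t \<omega>)"

text \<open>The coordinates are independent as processes, i.e. as random elements of the
  product space of real functions on \<open>{0..}\<close>.\<close>

locale brownian_motion = prob_space P for P :: "'w measure" +
  fixes d :: nat and B :: "nat \<Rightarrow> real \<Rightarrow> 'w \<Rightarrow> real"
  assumes standard_coordinates: "\<And>j. j \<in> {1..d} \<Longrightarrow> standard_brownian_motion P (B j)"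
    and indep_coordinates:
      "indep_vars (\<lambda>_. \<Pi>\<^sub>M t\<in>{0..}. borel) (\<lambda>j \<omega>. \<lambda>t\<in>{0..}. B j t \<omega>) {1..d}"

text \<open>On \<open>{0..T}\<close> this is the piecewise linear interpolation of \<open>x\<close> at the points
  \<open>k * T / M\<close>; at \<open>t = T\<close> the value of \<open>x\<close> beyond \<open>T\<close> is multiplied by \<open>0\<close>.\<close>

definition pw_linear :: "nat \<Rightarrow> real \<Rightarrow> (real \<Rightarrow> real) \<Rightarrow> real \<Rightarrow> real" where
  "pw_linear M T x t =
     (let h = T / real M; k = real (nat \<lfloor>t / h\<rfloor>)
      in x (k * h) + (t - k * h) / h * (x ((k + 1) * h) - x (k * h)))"

text \<open>\<open>iter_integral X (rev w) T\<close> is the iterated integral of the path with coordinates \<open>X i\<close>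
  along the word \<open>w\<close> over \<open>0 < u\<^sub>1 < \<dots> < u\<^sub>n < T\<close>; the head of the argument is the
  letter integrated last.  For piecewise linear \<open>X\<close>, \<open>d (X i) u\<close> is \<open>deriv (X i) u du\<close>,
  the derivative existing off a finite set.\<close>

fun iter_integral :: "(nat \<Rightarrow> real \<Rightarrow> real) \<Rightarrow> nat list \<Rightarrow> real \<Rightarrow> real" where
  "iter_integral X [] t = 1"
| "iter_integral X (i # w) t = integral {0..t} (\<lambda>u. iter_integral X w u * deriv (X i) u)"

definition sig_coeff :: "(nat \<Rightarrow> real \<Rightarrow> real) \<Rightarrow> real \<Rightarrow> nat list \<Rightarrow> real" where
  "sig_coeff X T w = iter_integral X (rev w) T"

definition expected_sig_coeff ::
    "'w measure \<Rightarrow> (nat \<Rightarrow> real \<Rightarrow> 'w \<Rightarrow> real) \<Rightarrow> nat \<Rightarrow> real \<Rightarrow> nat list \<Rightarrow> real" where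
  "expected_sig_coeff P B M T w =
     (\<integral>\<omega>. sig_coeff (\<lambda>i. pw_linear M T (\<lambda>t. B i t \<omega>)) T w \<partial>P)"

text \<open>The letter \<open>e\<^sub>i\<close> is represented by the index \<open>i \<in> {1..d}\<close>.  The argument \<open>n\<close> of
  \<open>S_words\<close>, \<open>K_words\<close> and \<open>W_words\<close> is half the length of the words.\<close>

definition S_words :: "nat \<Rightarrow> nat \<Rightarrow> nat list set" where
  "S_words d n = {concat (map (\<lambda>i. [i, i]) v) | v. length v = n \<and> set v \<subseteq> {1..d}}"

definition K_words :: "nat \<Rightarrow> nat \<Rightarrow> nat list set" where
  "K_words d n = {w. set w \<subseteq> {1..d} \<and> length w = 2 * n \<and> (\<forall>i\<in>{1..d}. even (count_list w i))}"

definition E_words :: "nat \<Rightarrow> nat list set" where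
  "E_words d = (\<Union>i\<in>{1..d}. \<Union>j\<in>{1..d} - {i}. {[i, j, i, j], [i, j, j, i]})"

definition W_words_at :: "nat \<Rightarrow> nat \<Rightarrow> nat \<Rightarrow> nat list set" where
  "W_words_at d n k =
     {v @ v' @ v'' | v v' v''. v \<in> S_words d k \<and> v' \<in> E_words d \<and> v'' \<in> S_words d (n - 2 - k)}"

definition W_words :: "nat \<Rightarrow> nat \<Rightarrow> nat list set" where
  "W_words d n = (\<Union>k\<in>{k. k + 2 \<le> n}. W_words_at d n k)"

end

theory Submission
  imports Defs
begin

text \<open>
  Over one step of length \<open>h = T / M\<close> the interpolated path is a straight segment, whose signature
  coefficient along \<open>v\<close> is the product of the increments indexed by \<open>v\<close>, divided by \<open>|v|!\<close>.
  Chen's identity therefore writes the coefficient of \<open>w\<close> as a sum over all ways of cutting \<open>w\<close> into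
  \<open>M\<close> consecutive, possibly empty blocks, one per step (\<open>iter_integral_grid\<close>).  Since the increments
  of the steps and of the coordinates are independent, taking expectations replaces each block product by
  a product of Gaussian moments (\<open>expected_sig_coeff_eq_block_sum\<close>).

  Such a moment vanishes unless every letter occurs an even number of times in the block, and it is at
  most \<open>h ^ (|v| / 2) * |v|!\<close>.  Hence the coefficient of a word of length \<open>2 * n\<close> is at most
  \<open>h ^ n\<close> times the number of ways to place the cuts so that all blocks are even.  If \<open>w\<close> cannot be cut
  into more than \<open>p\<close> nonempty even blocks, this number is of order \<open>M ^ p\<close>, since only the choice of the
  steps that carry the nonempty blocks grows with \<open>M\<close> (\<open>block_sum_le\<close>).

  It remains to see that \<open>p = n - 2\<close> is possible for the words of the theorem
  (\<open>even_splits_generic\<close>).  Each nonempty even block has length at least 2.  A cut into \<open>n\<close> blocks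
  consists of squares, so the word is in \<open>S_words\<close>; a cut into \<open>n - 1\<close> blocks consists of squares and
  one even block of length 4, which is either a product of two squares or a word of \<open>E_words\<close>, so
  the word is in \<open>S_words\<close> or \<open>W_words\<close>.  The bound is then of order
  \<open>(T / M) ^ n * M ^ (n - 2) = T ^ n / M\<^sup>2\<close>, and there are finitely many words.
\<close>

section \<open>Iterated integrals of piecewise linear paths\<close>

text \<open>Unfolding the recursion gives the sum over all cuts of \<open>w\<close> into \<open>k\<close> consecutive blocks, where
  \<open>g l\<close>, divided by a factorial, weights the block of step \<open>l\<close>; the block of the last step comes first in
  \<open>w\<close>, because \<open>iter_integral\<close> takes words reversed.  Leaving \<open>g\<close> open lets the same recursion
  describe both the random coefficients and their expectations.\<close>

primrec block_sum :: "(nat \<Rightarrow> 'a list \<Rightarrow> real) \<Rightarrow> nat \<Rightarrow> 'a list \<Rightarrow> real" where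
  "block_sum g 0 w = (if w = [] then 1 else 0)"
| "block_sum g (Suc k) w =
     (\<Sum>j\<le>length w. block_sum g k (drop j w) * g k (take j w) / fact j)"

definition incr :: "(nat \<Rightarrow> real \<Rightarrow> real) \<Rightarrow> real \<Rightarrow> nat \<Rightarrow> nat \<Rightarrow> real" where
  "incr x h k i = x i (real (Suc k) * h) - x i (real k * h)"

definition monom_incr :: "(nat \<Rightarrow> real \<Rightarrow> real) \<Rightarrow> real \<Rightarrow> nat \<Rightarrow> nat list \<Rightarrow> real" where
  "monom_incr x h k v = (\<Prod>i\<leftarrow>v. incr x h k i)"

lemma deriv_pw_linear:
  fixes x :: "nat \<Rightarrow> real \<Rightarrow> real"
  assumes "0 < M" "0 < T" "h = T / real M" and u: "real k * h < u" "u < real (Suc k) * h"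
  shows "deriv (pw_linear M T (x i)) u = incr x h k i / h"
proof -
  have h: "h > 0" using assms by simp
  have "((\<lambda>t. x i (real k * h) + (t - real k * h) / h * incr x h k i)
          has_field_derivative incr x h k i / h) (at u)"
    using h by (auto intro!: derivative_eq_intros)
  then have "(pw_linear M T (x i) has_field_derivative incr x h k i / h) (at u)"
  proof (rule has_field_derivative_transform_within_open)
    show "open {real k * h<..<real (Suc k) * h}" "u \<in> {real k * h<..<real (Suc k) * h}"
      using u by auto
    fix t assume "t \<in> {real k * h<..<real (Suc k) * h}"
    then have "real k < t / h" "t / h < real k + 1"
      using h by (simp_all add: field_simps)
    then have "\<lfloor>t / h\<rfloor> = int k" by linarith
    then show "x i (real k * h) + (t - real k * h) / h * incr x h k i = pw_linear M T (x i) t"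
      unfolding pw_linear_def Let_def incr_def assms(3)[symmetric] by (simp add: add.commute)
  qed
  then show ?thesis by (rule DERIV_imp_deriv)
qed

text \<open>Chen's identity in between grid points.  The induction on \<open>w\<close> needs the integrand on the whole
  interval, not only its values on the grid; inside one step it is a polynomial, because the last letters
  integrated there form a prefix of \<open>w\<close> and contribute a power of the elapsed fraction of the step.\<close>

lemma iter_integral_pw_linear:
  fixes x :: "nat \<Rightarrow> real \<Rightarrow> real"
  assumes M: "0 < M" "0 < T" and h_def: "h = T / real M"
    and "real k * h \<le> t" "t \<le> real (Suc k) * h"
  shows "iter_integral (\<lambda>i. pw_linear M T (x i)) w t =
     (\<Sum>j\<le>length w. block_sum (monom_incr x h) k (drop j w) * monom_incr x h k (take j w)
        * ((t - real k * h) / h) ^ j / fact j)"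
  using assms(4,5)
proof (induction w arbitrary: k t)
  case Nil
  have "block_sum (monom_incr x h) k [] = 1"
    by (induction k) (simp_all add: monom_incr_def)
  then show ?case using monom_incr_def[of x h k "[]"] by simp
next
  case (Cons i w)
  let ?b = "block_sum (monom_incr x h)" and ?m = "monom_incr x h" and ?D = "\<lambda>k. incr x h k i"
  define F where "F = (\<lambda>u. iter_integral (\<lambda>i. pw_linear M T (x i)) w u * deriv (pw_linear M T (x i)) u)"
  define G where "G = (\<lambda>k t. \<Sum>j\<le>length w. ?b k (drop j w) * (?D k * ?m k (take j w))
        * ((t - real k * h) / h) ^ Suc j / fact (Suc j))"
  have h: "h > 0" using M h_def by simp
  \<comment> \<open>The derivative may fail to exist at the two grid points, which are discarded as a finite set.\<close>
  have piece: "(F has_integral G k t) {real k * h..t}"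
    if t: "real k * h \<le> t" "t \<le> real (Suc k) * h" for k t
  proof (rule has_integral_spike_finite[of "{real k * h, real (Suc k) * h}"])
    let ?f = "\<lambda>u. (\<Sum>j\<le>length w. ?b k (drop j w) * ?m k (take j w)
        * ((u - real k * h) / h) ^ j / fact j) * (?D k / h)"
    show "F u = ?f u" if "u \<in> {real k * h..t} - {real k * h, real (Suc k) * h}" for u
    proof -
      have "real k * h < u" "u < real (Suc k) * h" using that t by auto
      then show ?thesis
        unfolding F_def by (subst Cons.IH[of k]) (auto simp: deriv_pw_linear[OF M h_def])
    qed
    have "(?f has_integral G k t - G k (real k * h)) {real k * h..t}"
    proof (rule fundamental_theorem_of_calculus)
      fix u
      have "((\<lambda>u. G k u) has_real_derivative ?f u) (at u)"
        unfolding G_def sum_distrib_right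
      proof (rule DERIV_sum)
        fix j
        have "((\<lambda>u. ((u - real k * h) / h) ^ Suc j / fact (Suc j)) has_real_derivative
            ((u - real k * h) / h) ^ j / fact j / h) (at u)"
        proof -
          have "((\<lambda>u. (u - real k * h) / h) has_real_derivative 1 / h) (at u)"
            using h by (auto intro!: derivative_eq_intros)
          from DERIV_cdivide[OF DERIV_power[OF this, of "Suc j"], of "fact (Suc j)"]
          show ?thesis by (simp add: divide_simps mult_ac del: of_nat_Suc)
        qed
        from DERIV_cmult[OF this, of "?b k (drop j w) * (?D k * ?m k (take j w))"]
        show "((\<lambda>u. ?b k (drop j w) * (?D k * ?m k (take j w)) * ((u - real k * h) / h) ^ Suc j / fact (Suc j))
            has_real_derivative ?b k (drop j w) * ?m k (take j w)
              * ((u - real k * h) / h) ^ j / fact j * (?D k / h)) (at u)"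
          by (simp add: mult_ac)
      qed
      then show "(G k has_vector_derivative ?f u) (at u within {real k * h..t})"
        by (simp add: has_real_derivative_iff_has_vector_derivative has_vector_derivative_at_within)
    qed (use t in auto)
    moreover have "G k (real k * h) = 0" by (simp add: G_def)
    ultimately show "(?f has_integral G k t) {real k * h..t}" by simp
  qed auto
  \<comment> \<open>The term for the empty prefix is the value at the left grid point.\<close>
  have expand: "?b k (i # w) + G k t =
     (\<Sum>j\<le>length (i # w). ?b k (drop j (i # w)) * ?m k (take j (i # w))
        * ((t - real k * h) / h) ^ j / fact j)" for k t
    by (simp only: list.size add_Suc_right add_0_right sum.atMost_Suc_shift)
       (simp add: G_def monom_incr_def)
  have grid: "(F has_integral ?b k (i # w)) {0..real k * h}" for k
  proof (induction k)
    case 0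
    then show ?case by (simp add: has_integral_refl)
  next
    case (Suc k)
    have "(F has_integral ?b k (i # w) + G k (real (Suc k) * h)) {0..real (Suc k) * h}"
      using h by (intro has_integral_combine[OF _ _ Suc.IH piece]) (auto simp: mult_right_mono)
    moreover have "(real (Suc k) * h - real k * h) / h = 1"
      using h by (simp add: field_simps)
    ultimately show ?case by (simp only: expand) (simp only: block_sum.simps power_one mult_1_right)
  qed
  have "(F has_integral ?b k (i # w) + G k t) {0..t}"
    using h Cons.prems by (intro has_integral_combine[OF _ _ grid piece]) auto
  then show ?case
    by (simp only: expand iter_integral.simps F_def[symmetric] integral_unique)
qed

lemma iter_integral_grid:
  fixes x :: "nat \<Rightarrow> real \<Rightarrow> real"
  assumes "0 < M" "0 < T"
  shows "iter_integral (\<lambda>i. pw_linear M T (x i)) w T = block_sum (monom_incr x (T / real M)) M w"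
proof -
  obtain k where k: "M = Suc k" using assms by (cases M) auto
  have T: "real (Suc k) * (T / real M) = T" "real k * (T / real M) \<le> T" "(T - real k * (T / real M)) / (T / real M) = 1"
    using assms by (auto simp: k field_simps)
  show ?thesis
    using iter_integral_pw_linear[OF assms refl T(2), of x w] unfolding T by (simp add: k)
qed

section \<open>Cutting words into even blocks\<close>

definition even_word :: "'a list \<Rightarrow> bool" where
  "even_word w \<longleftrightarrow> (\<forall>i. even (count_list w i))"

definition even_splits :: "'a list \<Rightarrow> 'a list list set" where
  "even_splits w = {bs. concat bs = w \<and> (\<forall>b\<in>set bs. b \<noteq> [] \<and> even_word b)}"

lemma even_word_append: "even_word v \<Longrightarrow> even_word (v @ w) \<longleftrightarrow> even_word w"
  by (auto simp: even_word_def)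

lemma even_length: "even_word w \<Longrightarrow> even (length w)"
  by (metis even_word_def dvd_sum sum_count_set finite_set subset_refl)

lemma even_word_length_ge: "even_word b \<Longrightarrow> b \<noteq> [] \<Longrightarrow> 2 \<le> length b"
  using even_length[of b] by (cases "length b") (auto elim!: oddE)

lemma even_word_length2: "even_word b \<Longrightarrow> length b = 2 \<Longrightarrow> \<exists>i. b = [i, i]"
  by (auto simp: even_word_def numeral_2_eq_2 length_Suc_conv split: if_splits)

lemma S_words_Cons: "i \<in> {1..d} \<Longrightarrow> v \<in> S_words d n \<Longrightarrow> [i, i] @ v \<in> S_words d (Suc n)"
  unfolding S_words_def by clarify (rule exI[where x = "i # _"], auto)

lemma W_words_Cons:
  assumes "i \<in> {1..d}" "w \<in> W_words d n"
  shows "[i, i] @ w \<in> W_words d (Suc n)"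
proof -
  obtain k v v' v'' where *: "k + 2 \<le> n" "w = v @ v' @ v''" "v \<in> S_words d k" "v' \<in> E_words d"
     "v'' \<in> S_words d (n - 2 - k)"
    using assms(2) by (auto simp: W_words_def W_words_at_def)
  have "[i, i] @ w = ([i, i] @ v) @ v' @ v''" "Suc n - 2 - Suc k = n - 2 - k" using * by auto
  then have "[i, i] @ w \<in> W_words_at d (Suc n) (Suc k)"
    unfolding W_words_at_def using * S_words_Cons[OF assms(1) *(3)] by (metis (mono_tags, lifting) mem_Collect_eq)
  moreover have "Suc k + 2 \<le> Suc n" using * by simp
  ultimately show ?thesis by (auto simp: W_words_def)
qed

text \<open>If the first two letters agree then so do the last two, and otherwise the last two are a
  permutation of the first two.\<close>

lemma even_word_length4:
  assumes "even_word b" "length b = 4" "set b \<subseteq> {1..d}"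
  shows "b \<in> S_words d 2 \<union> E_words d"
proof -
  obtain p q r s where b: "b = [p, q, r, s]"
    using assms(2) by (auto simp: eval_nat_numeral length_Suc_conv)
  have ev: "even (count_list b i)" for i using assms(1) by (simp add: even_word_def)
  have "p = q \<and> r = s \<or> p \<noteq> q \<and> (r = p \<and> s = q \<or> r = q \<and> s = p)"
    using ev[of p] ev[of q] ev[of r] ev[of s] by (auto simp: b split: if_splits)
  then consider "p = q" "r = s" | "p \<noteq> q" "r = p" "s = q" | "p \<noteq> q" "r = q" "s = p" by blast
  then show ?thesis
  proof cases
    case 1
    then have "b = concat (map (\<lambda>i. [i, i]) [p, r])" by (simp add: b)
    then show ?thesis using assms(3) b unfolding S_words_def
      by (intro UnI1 CollectI exI[of _ "[p, r]"]) auto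
  qed (use assms(3) b in \<open>fastforce simp: E_words_def\<close>)+
qed

lemma even_splits_length:
  assumes "bs \<in> even_splits w"
  shows "2 * length bs \<le> length w"
proof -
  have "(\<forall>b\<in>set bs. 2 \<le> length b) \<Longrightarrow> 2 * length bs \<le> length (concat bs)" for bs :: "'a list list"
    by (induction bs) auto
  then show ?thesis using assms even_word_length_ge by (auto simp: even_splits_def)
qed

lemma even_splits_Cons:
  "b # bs \<in> even_splits w \<longleftrightarrow> (\<exists>w'. w = b @ w' \<and> b \<noteq> [] \<and> even_word b \<and> bs \<in> even_splits w')"
  by (auto simp: even_splits_def)

text \<open>The bound \<open>2 * length bs \<le> length w\<close> is attained only if every block is a square.\<close>

lemma even_splits_maximal:
  assumes "bs \<in> even_splits w" "length w = 2 * length bs" "set w \<subseteq> {1..d}"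
  shows "w \<in> S_words d (length bs)"
  using assms
proof (induction bs arbitrary: w)
  case Nil
  then show ?case by (auto simp: S_words_def)
next
  case (Cons b bs)
  then obtain w' where w: "w = b @ w'" "b \<noteq> []" "even_word b" "bs \<in> even_splits w'"
    by (auto simp: even_splits_Cons)
  have "2 * length bs \<le> length w'" "2 \<le> length b"
    using even_splits_length w even_word_length_ge by auto
  then have l: "length w' = 2 * length bs" "length b = 2" using Cons.prems w by auto
  then obtain i where "b = [i, i]" using even_word_length2 w by blast
  then show ?case using S_words_Cons[of i d w'] Cons.IH[OF w(4) l(1)] Cons.prems w by auto
qed

text \<open>One block exceeds the minimal length 2, and by parity it has length exactly 4.  The induction
  strips squares until this block comes first; what follows it is then a maximal cut.\<close>

lemma even_splits_almost_maximal:
  assumes "bs \<in> even_splits w" "length w = 2 * Suc (length bs)" "set w \<subseteq> {1..d}"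
  shows "w \<in> S_words d (Suc (length bs)) \<union> W_words d (Suc (length bs))"
  using assms
proof (induction bs arbitrary: w)
  case Nil
  then show ?case by (auto simp: even_splits_def)
next
  case (Cons b bs)
  then obtain w' where w: "w = b @ w'" "b \<noteq> []" "even_word b" "bs \<in> even_splits w'"
    by (auto simp: even_splits_Cons)
  have ge: "2 * length bs \<le> length w'" "2 \<le> length b"
    using even_splits_length w even_word_length_ge by auto
  show ?case
  proof (cases "length b = 2")
    case True
    then obtain i where i: "b = [i, i]" using even_word_length2 w by blast
    have "w' \<in> S_words d (Suc (length bs)) \<union> W_words d (Suc (length bs))"
      by (rule Cons.IH[OF w(4)]) (use Cons.prems w True in auto)
    then show ?thesis
      using S_words_Cons[of i d w'] W_words_Cons[of i d w'] Cons.prems w i by auto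
  next
    case False
    have "length b = 4" "length w' = 2 * length bs"
      using ge False Cons.prems(2) even_length[OF w(3)] by (auto simp: w elim!: evenE)
    then have w': "w' \<in> S_words d (length bs)" and b: "b \<in> S_words d 2 \<union> E_words d"
      using even_splits_maximal[OF w(4)] even_word_length4[OF w(3)] Cons.prems(3) w(1) by auto
    show ?thesis
    proof (cases "b \<in> E_words d")
      case True
      \<comment> \<open>The squares in front of the long block are restored by the other case of the induction.\<close>
      then have "w \<in> W_words_at d (Suc (length (b # bs))) 0"
        using w' w(1) unfolding W_words_at_def
        by (intro CollectI exI[of _ "[]"] exI[of _ b] exI[of _ w']) (auto simp: S_words_def)
      then show ?thesis by (auto simp: W_words_def)
    next
      case False
      then obtain p q where "b = concat (map (\<lambda>i. [i, i]) [p, q])" "p \<in> {1..d}" "q \<in> {1..d}"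
        using b by (auto simp: S_words_def eval_nat_numeral length_Suc_conv)
      then have "w = [p, p] @ [q, q] @ w'" "w \<in> S_words d (Suc (Suc (length bs)))"
        using w(1) S_words_Cons[of p d "[q, q] @ w'"] S_words_Cons[of q d w'] w' by auto
      then show ?thesis by simp
    qed
  qed
qed

lemma even_splits_generic:
  assumes "w \<in> K_words d n - (S_words d n \<union> W_words d n)" "bs \<in> even_splits w"
  shows "length bs + 2 \<le> n"
proof (rule ccontr)
  assume less: "\<not> length bs + 2 \<le> n"
  have w: "length w = 2 * n" "set w \<subseteq> {1..d}" using assms(1) by (auto simp: K_words_def)
  then have "length bs = n \<or> Suc (length bs) = n"
    using even_splits_length[OF assms(2)] less by auto
  then show False
    using even_splits_maximal[OF assms(2), of d] even_splits_almost_maximal[OF assms(2), of d] w assms(1) by auto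
qed

lemma K_words_even: "w \<in> K_words d n \<Longrightarrow> even_word w"
  unfolding K_words_def even_word_def
  by (metis (mono_tags, lifting) count_list_0_iff dvd_0_right mem_Collect_eq subsetD)

lemma even_splits_rev:
  assumes "bs \<in> even_splits (rev w)"
  shows "map rev (rev bs) \<in> even_splits w"
proof -
  have "concat (map rev (rev bs)) = w"
    using assms by (metis (mono_tags, lifting) even_splits_def mem_Collect_eq rev_concat rev_rev_ident)
  then show ?thesis using assms by (auto simp: even_splits_def even_word_def)
qed

section \<open>Gaussian moments of words\<close>

definition gauss_moment :: "real \<Rightarrow> nat \<Rightarrow> real" where
  "gauss_moment v r = (if even r then v ^ (r div 2) * fact r / (2 ^ (r div 2) * fact (r div 2)) else 0)"

definition word_moment :: "nat \<Rightarrow> real \<Rightarrow> nat list \<Rightarrow> real" where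
  "word_moment d v w = (\<Prod>i\<in>{1..d}. gauss_moment v (count_list w i))"

lemma has_bochner_integral_gauss_moment:
  assumes "distributed P lborel X (normal_density 0 (sqrt v))" "0 < v"
  shows "has_bochner_integral P (\<lambda>\<omega>. X \<omega> ^ r) (gauss_moment v r)"
proof -
  have "has_bochner_integral lborel (\<lambda>x. normal_density 0 (sqrt v) x * x ^ r) (gauss_moment v r)"
  proof (cases "even r")
    case True
    then obtain k where "r = 2 * k" by (elim evenE)
    moreover from this have "gauss_moment v r = fact (2 * k) / ((2 / (sqrt v)\<^sup>2) ^ k * fact k)"
      using \<open>0 < v\<close> by (simp add: gauss_moment_def power_divide)
    ultimately show ?thesis
      using normal_moment_even[where \<mu> = 0 and \<sigma> = "sqrt v" and k = k] \<open>0 < v\<close>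
      by (simp only: diff_zero real_sqrt_gt_0_iff)
  next
    case False
    then obtain k where "r = 2 * k + 1" by (elim oddE)
    then show ?thesis
      using normal_moment_odd[of "sqrt v" 0 k] \<open>0 < v\<close> by (simp add: gauss_moment_def)
  qed
  then show ?thesis
    using distributed_integral[OF assms(1), of "\<lambda>x. x ^ r"]
      distributed_integrable[OF assms(1), of "\<lambda>x. x ^ r"]
    by (simp add: has_bochner_integral_iff)
qed

text \<open>The multinomial coefficient is an integer, hence at least 1.\<close>

lemma prod_fact_le_fact_sum:
  "finite A \<Longrightarrow> (\<Prod>i\<in>A. fact (f i)) \<le> (fact (\<Sum>i\<in>A. f i) :: nat)"
proof (induction A rule: finite_induct)
  case (insert a A)
  have "fact (f a) * (\<Prod>i\<in>A. fact (f i)) \<le> fact (f a) * (fact (\<Sum>i\<in>A. f i) :: nat)"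
    using insert by simp
  also have "\<dots> \<le> fact (f a + (\<Sum>i\<in>A. f i))"
    by (intro dvd_imp_le fact_fact_dvd_fact) simp
  finally show ?case using insert by simp
qed simp

lemma word_moment_odd:
  assumes "\<not> even_word w" "set w \<subseteq> {1..d}"
  shows "word_moment d v w = 0"
proof -
  obtain i where "odd (count_list w i)" using assms by (auto simp: even_word_def)
  moreover from this have "i \<in> {1..d}" using assms(2) by (metis count_list_0_iff dvd_0_right subsetD)
  ultimately show ?thesis by (auto simp: word_moment_def gauss_moment_def)
qed

lemma word_moment_nonneg: "0 \<le> v \<Longrightarrow> 0 \<le> word_moment d v w"
  by (auto simp: word_moment_def gauss_moment_def intro!: prod_nonneg)

text \<open>The factorial on the right cancels the one by which \<open>block_sum\<close> divides, so an even block of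
  length \<open>2 * r\<close> has weight at most \<open>v ^ r\<close>.\<close>

lemma word_moment_le:
  assumes "even_word w" "set w \<subseteq> {1..d}" "0 \<le> v"
  shows "word_moment d v w \<le> v ^ (length w div 2) * fact (length w)"
proof -
  let ?c = "count_list w"
  have len: "(\<Sum>i\<in>{1..d}. ?c i) = length w" using assms(2) by (simp add: sum_count_set)
  have "2 * (\<Sum>i\<in>{1..d}. ?c i div 2) = length w"
    using assms(1) unfolding len[symmetric] sum_distrib_left by (simp add: even_word_def)
  then have len2: "(\<Sum>i\<in>{1..d}. ?c i div 2) = length w div 2" by simp
  have "gauss_moment v (?c i) \<le> v ^ (?c i div 2) * fact (?c i)" for i
  proof -
    have "1 * 1 \<le> (2::real) ^ (?c i div 2) * fact (?c i div 2)" by (intro mult_mono) auto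
    then have "v ^ (?c i div 2) * fact (?c i) * 1 \<le>
        v ^ (?c i div 2) * fact (?c i) * (2 ^ (?c i div 2) * fact (?c i div 2))"
      using assms(3) by (intro mult_left_mono) auto
    then show ?thesis
      using assms(1) by (simp add: gauss_moment_def even_word_def divide_le_eq)
  qed
  then have "word_moment d v w \<le> (\<Prod>i\<in>{1..d}. v ^ (?c i div 2) * fact (?c i))"
    unfolding word_moment_def using assms(3)
    by (intro prod_mono) (auto simp: gauss_moment_def)
  also have "\<dots> = v ^ (length w div 2) * real (\<Prod>i\<in>{1..d}. fact (?c i))"
    by (simp only: prod.distrib power_sum[symmetric] len2 of_nat_prod of_nat_fact)
  also have "\<dots> \<le> v ^ (length w div 2) * real (fact (length w))"
    using assms(3) prod_fact_le_fact_sum[of "{1..d}" ?c] len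
    by (intro mult_left_mono of_nat_mono) auto
  finally show ?thesis by simp
qed

text \<open>The last step either carries the empty block, leaving \<open>w\<close> to the earlier steps, or it carries a
  nonempty even prefix, and then the remaining suffix admits one block fewer.  The second alternative
  is therefore smaller by a factor \<open>k + 1\<close>, and \<open>(k + 1) ^ p + (k + 1) ^ (p - 1) \<le> (k + 2) ^ p\<close> closes the
  induction on \<open>k\<close>.  The factor \<open>2 ^ length w\<close> absorbs the sum over the prefixes, the geometric sum of
  the powers for the shorter suffixes.  The base is \<open>k + 1\<close> instead of \<open>k\<close> so that the claim also holds
  for \<open>w = []\<close> and \<open>p > 0\<close> at \<open>k = 0\<close>.\<close>

lemma block_sum_le:
  assumes "even_word w" "set w \<subseteq> {1..d}" "0 \<le> v" "\<forall>bs\<in>even_splits w. length bs \<le> p"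
  shows "block_sum (\<lambda>_. word_moment d v) k w
    \<le> v ^ (length w div 2) * 2 ^ length w * (real k + 1) ^ p"
  using assms
proof (induction k arbitrary: w p)
  case 0
  then show ?case by auto
next
  case (Suc k)
  let ?b = "block_sum (\<lambda>_. word_moment d v)" and ?m = "word_moment d v" and ?l = "length w"
  let ?x = "real k + 1"
  show ?case
  proof (cases "w = []")
    case True
    have "?b k [] = 1" by (induction k) (auto simp: word_moment_def gauss_moment_def)
    moreover have "?m [] = 1" by (simp add: word_moment_def gauss_moment_def)
    ultimately show ?thesis using True by simp
  next
    case False
    \<comment> \<open>A nonempty even word is itself a block, so the exponent can be lowered.\<close>
    then have "[w] \<in> even_splits w" using Suc.prems by (auto simp: even_splits_def)
    then obtain q where p: "p = Suc q" using Suc.prems(4) by (cases p) auto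
    have first: "?b k w \<le> v ^ (?l div 2) * 2 ^ ?l * ?x ^ p"
      by (rule Suc.IH) (use Suc.prems in auto)
    have later: "?b k (drop j w) * ?m (take j w) / fact j
        \<le> v ^ (?l div 2) * ?x ^ q * 2 ^ (?l - j)" if j: "j \<in> {1..?l}" for j
    proof (cases "even_word (take j w)")
      case False
      moreover have "set (take j w) \<subseteq> {1..d}" using Suc.prems(2) set_take_subset by fastforce
      ultimately show ?thesis using Suc.prems by (simp add: word_moment_odd)
    next
      case True
      have w: "take j w @ drop j w = w" "take j w \<noteq> []" using j by auto
      have ev: "even_word (drop j w)" using even_word_append[OF True] w(1) Suc.prems(1) by metis
      have splits: "\<forall>bs\<in>even_splits (drop j w). length bs \<le> q"
      proof
        fix bs assume "bs \<in> even_splits (drop j w)"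
        then have "take j w # bs \<in> even_splits w" using True w even_splits_Cons by metis
        then show "length bs \<le> q" using Suc.prems(4) p by force
      qed
      have sets: "set (take j w) \<subseteq> {1..d}" "set (drop j w) \<subseteq> {1..d}"
        using Suc.prems(2) set_take_subset set_drop_subset by fastforce+
      have "?b k (drop j w) \<le> v ^ ((?l - j) div 2) * 2 ^ (?l - j) * ?x ^ q"
        using Suc.IH[OF ev sets(2) Suc.prems(3) splits] by simp
      moreover have "?m (take j w) / fact j \<le> v ^ (j div 2)"
        using word_moment_le[OF True sets(1) Suc.prems(3)] j by (simp add: divide_le_eq)
      ultimately have "?b k (drop j w) * (?m (take j w) / fact j)
          \<le> (v ^ ((?l - j) div 2) * 2 ^ (?l - j) * ?x ^ q) * v ^ (j div 2)"
        using Suc.prems(3) word_moment_nonneg by (intro mult_mono) auto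
      moreover have "?l div 2 = (?l - j) div 2 + j div 2"
        using even_length[OF True] even_length[OF ev] j by (auto elim!: evenE)
      ultimately show ?thesis by (simp add: power_add mult_ac)
    qed
    have geo: "(\<Sum>j\<in>{1..?l}. (2::real) ^ (?l - j)) \<le> 2 ^ ?l"
    proof -
      have "(\<Sum>j\<in>{1..?l}. (2::real) ^ (?l - j)) = (\<Sum>i<?l. 2 ^ i)"
        by (rule sum.reindex_bij_witness[of _ "\<lambda>i. ?l - i" "\<lambda>j. ?l - j"]) auto
      then show ?thesis by (simp add: sum_gp_strict)
    qed
    have "?b (Suc k) w = ?b k w + (\<Sum>j\<in>{1..?l}. ?b k (drop j w) * ?m (take j w) / fact j)"
      by (simp add: atMost_atLeast0 sum.atLeast_Suc_atMost word_moment_def gauss_moment_def)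
    also have "\<dots> \<le> v ^ (?l div 2) * 2 ^ ?l * ?x ^ p
        + (\<Sum>j\<in>{1..?l}. v ^ (?l div 2) * ?x ^ q * 2 ^ (?l - j))"
      by (intro add_mono first sum_mono later)
    also have "\<dots> \<le> v ^ (?l div 2) * 2 ^ ?l * ?x ^ p + v ^ (?l div 2) * ?x ^ q * 2 ^ ?l"
      unfolding sum_distrib_left[symmetric] using Suc.prems(3) geo
      by (intro add_left_mono mult_left_mono) auto
    also have "\<dots> = v ^ (?l div 2) * 2 ^ ?l * (?x ^ q * (?x + 1))"
      by (simp add: p algebra_simps)
    also have "\<dots> \<le> v ^ (?l div 2) * 2 ^ ?l * ((?x + 1) ^ q * (?x + 1))"
      using Suc.prems(3) by (intro mult_left_mono mult_right_mono power_mono) auto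
    also have "\<dots> = v ^ (?l div 2) * 2 ^ ?l * (real (Suc k) + 1) ^ p"
      by (simp add: p algebra_simps)
    finally show ?thesis .
  qed
qed

section \<open>Expectations of products of increments\<close>

lemma prod_list_count_list:
  fixes f :: "'a \<Rightarrow> real"
  assumes "set v \<subseteq> A" "finite A"
  shows "(\<Prod>i\<leftarrow>v. f i) = (\<Prod>i\<in>A. f i ^ count_list v i)"
  using assms(1)
proof (induction v)
  case (Cons a v)
  have "(\<Prod>i\<in>A. f i ^ count_list (a # v) i) = (\<Prod>i\<in>A. (if a = i then f a else 1) * f i ^ count_list v i)"
    by (intro prod.cong) auto
  also have "\<dots> = f a * (\<Prod>i\<in>A. f i ^ count_list v i)"
    using Cons.prems assms(2) by (simp add: prod.distrib prod.delta)
  finally show ?case using Cons by simp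
qed simp

context brownian_motion begin

text \<open>Grouping the factors by coordinate avoids joint independence of all increments: the factors of
  different coordinates are functions of independent processes, and within one coordinate the increments
  over the steps are independent.\<close>

lemma has_bochner_integral_monom_incr:
  assumes h: "0 < h" and v: "\<And>k. set (v k) \<subseteq> {1..d}"
  shows "has_bochner_integral P (\<lambda>\<omega>. \<Prod>k<m. monom_incr (\<lambda>i t. B i t \<omega>) h k (v k))
           (\<Prod>k<m. word_moment d h (v k))"
proof -
  define c where "c i k = count_list (v k) i" for i k
  define X where "X i \<omega> = (\<Prod>k<m. (B i (real (Suc k) * h) \<omega> - B i (real k * h) \<omega>) ^ c i k)" for i \<omega>
  have X: "has_bochner_integral P (X i) (\<Prod>k<m. gauss_moment h (c i k))" if i: "i \<in> {1..d}" for i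
  proof -
    interpret W: standard_brownian_motion P "B i" by (rule standard_coordinates[OF i])
    let ?Y = "\<lambda>k \<omega>. (B i (real (Suc k) * h) \<omega> - B i (real k * h) \<omega>) ^ c i k"
    have "indep_vars (\<lambda>_. borel) (\<lambda>k \<omega>. B i (real (Suc k) * h) \<omega> - B i (real k * h) \<omega>) {..<m}"
      by (rule W.indep_increments) (use h in \<open>auto intro!: monoI mult_right_mono\<close>)
    then have ind: "indep_vars (\<lambda>_. borel) ?Y {..<m}"
      by (rule indep_vars_compose2[where Y = "\<lambda>k x. x ^ c i k"]) simp
    have "distributed P lborel (\<lambda>\<omega>. B i (real (Suc k) * h) \<omega> - B i (real k * h) \<omega>)
        (normal_density 0 (sqrt h))" for k
      using W.gaussian_increments[of "real k * h" "real (Suc k) * h"] h by (simp add: algebra_simps)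
    then have mom: "has_bochner_integral P (?Y k) (gauss_moment h (c i k))" for k
      using has_bochner_integral_gauss_moment h by fastforce
    then show ?thesis
      unfolding X_def has_bochner_integral_iff
      using indep_vars_lebesgue_integral[OF _ ind] indep_vars_integrable[OF _ ind]
      by (simp add: has_bochner_integral_iff)
  qed
  have "indep_vars (\<lambda>_. borel) (\<lambda>i \<omega>. (\<Prod>k<m. ((\<lambda>t\<in>{0..}. B i t \<omega>) (real (Suc k) * h)
      - (\<lambda>t\<in>{0..}. B i t \<omega>) (real k * h)) ^ c i k)) {1..d}"
    by (rule indep_vars_compose2[OF indep_coordinates,
          where Y = "\<lambda>i f. \<Prod>k<m. (f (real (Suc k) * h) - f (real k * h)) ^ c i k"])
       (use h in \<open>intro borel_measurable_prod borel_measurable_power borel_measurable_diff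
          measurable_component_singleton; auto\<close>)
  then have ind: "indep_vars (\<lambda>_. borel) X {1..d}"
    using h unfolding X_def by simp
  have "has_bochner_integral P (\<lambda>\<omega>. \<Prod>i\<in>{1..d}. X i \<omega>) (\<Prod>i\<in>{1..d}. \<Prod>k<m. gauss_moment h (c i k))"
    using indep_vars_lebesgue_integral[OF _ ind] indep_vars_integrable[OF _ ind] X
    by (simp add: has_bochner_integral_iff)
  moreover have "(\<Prod>i\<in>{1..d}. X i \<omega>) = (\<Prod>k<m. monom_incr (\<lambda>i t. B i t \<omega>) h k (v k))" for \<omega>
    unfolding X_def monom_incr_def prod_list_count_list[OF v finite_atLeastAtMost]
    by (subst prod.swap) (simp add: c_def incr_def)
  moreover have "(\<Prod>i\<in>{1..d}. \<Prod>k<m. gauss_moment h (c i k)) = (\<Prod>k<m. word_moment d h (v k))"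
    unfolding word_moment_def c_def by (rule prod.swap)
  ultimately show ?thesis by simp
qed

text \<open>Increments of the steps from \<open>k\<close> on are carried along in the induction, so that when step \<open>k\<close> is
  split off its block merely joins this tail.  Everything reduces to the expectation of a single
  product of increments, and independence of \<open>block_sum\<close> from later increments never has to be stated.\<close>

lemma has_bochner_integral_block_sum_tail:
  assumes h: "0 < h" and "k \<le> m" "set w \<subseteq> {1..d}" "\<And>l. set (v l) \<subseteq> {1..d}"
  shows "has_bochner_integral P
      (\<lambda>\<omega>. block_sum (monom_incr (\<lambda>i t. B i t \<omega>) h) k w
             * (\<Prod>l\<in>{k..<m}. monom_incr (\<lambda>i t. B i t \<omega>) h l (v l)))
      (block_sum (\<lambda>_. word_moment d h) k w * (\<Prod>l\<in>{k..<m}. word_moment d h (v l)))"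
  using assms(2-)
proof (induction k arbitrary: w v)
  case 0
  then show ?case
    using has_bochner_integral_monom_incr[OF h, of v m] by (auto simp: atLeast0LessThan)
next
  case (Suc k)
  have split: "block_sum g (Suc k) w * (\<Prod>l\<in>{Suc k..<m}. g l (v l)) =
     (\<Sum>j\<le>length w. block_sum g k (drop j w) * (\<Prod>l\<in>{k..<m}. g l ((v(k := take j w)) l)) / fact j)"
    for g :: "nat \<Rightarrow> nat list \<Rightarrow> real"
  proof -
    have "(\<Prod>l\<in>{k..<m}. g l ((v(k := u)) l)) = g k u * (\<Prod>l\<in>{Suc k..<m}. g l (v l))" for u
      using Suc.prems(1) by (simp add: prod.atLeast_Suc_lessThan)
    then show ?thesis
      by (simp only: block_sum.simps sum_distrib_right) (auto intro!: sum.cong simp: mult_ac)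
  qed
  have "has_bochner_integral P
      (\<lambda>\<omega>. block_sum (monom_incr (\<lambda>i t. B i t \<omega>) h) k (drop j w)
             * (\<Prod>l\<in>{k..<m}. monom_incr (\<lambda>i t. B i t \<omega>) h l ((v(k := take j w)) l)))
      (block_sum (\<lambda>_. word_moment d h) k (drop j w)
             * (\<Prod>l\<in>{k..<m}. word_moment d h ((v(k := take j w)) l)))" for j
  proof (rule Suc.IH)
    show "set (drop j w) \<subseteq> {1..d}" "set ((v(k := take j w)) l) \<subseteq> {1..d}" for l
      using Suc.prems set_drop_subset[of j w] set_take_subset[of j w] by (auto simp del: atLeastAtMost_iff)
  qed (use Suc.prems in simp)
  then show ?case
    unfolding split[of "monom_incr _ h"] split[of "\<lambda>_. word_moment d h"]
    by (intro has_bochner_integral_sum has_bochner_integral_divide_zero)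
qed

lemma expected_sig_coeff_eq_block_sum:
  assumes "0 < M" "0 < T" "set w \<subseteq> {1..d}"
  shows "expected_sig_coeff P B M T w = block_sum (\<lambda>_. word_moment d (T / real M)) M (rev w)"
proof -
  have "0 < T / real M" using assms by simp
  from has_bochner_integral_block_sum_tail[OF this order_refl, of "rev w" "\<lambda>_. []" M] assms(3)
  show ?thesis
    unfolding expected_sig_coeff_def sig_coeff_def
      iter_integral_grid[OF assms(1,2), where x = "\<lambda>i t. B i t _"]
    by (simp add: has_bochner_integral_iff)
qed

text \<open>The constant \<open>8 ^ n\<close> collects \<open>2 ^ (2 * n)\<close> from the cuts and the passage from \<open>M + 1\<close> to
  \<open>2 * M\<close> in a power of exponent \<open>n - 2\<close>.\<close>

lemma expected_sig_coeff_le: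
  assumes w: "w \<in> K_words d n - (S_words d n \<union> W_words d n)" and "0 < M" "0 < T"
  shows "expected_sig_coeff P B M T w \<le> 8 ^ n * T ^ n / (real M)\<^sup>2"
proof -
  have w': "set w \<subseteq> {1..d}" "length w = 2 * n" "even_word w"
    using w K_words_even by (auto simp: K_words_def)
  \<comment> \<open>Some cut always exists, so the bound on the number of blocks forces \<open>n \<ge> 2\<close>.\<close>
  then have "[w] \<in> even_splits w \<or> [] \<in> even_splits w" by (auto simp: even_splits_def)
  then obtain q where n: "n = q + 2"
    using even_splits_generic[OF w] by (metis add.commute le_Suc_ex le_add2 le_trans)
  \<comment> \<open>\<open>sig_coeff\<close> reverses words, which reverses their cuts.\<close>
  have splits: "\<forall>bs\<in>even_splits (rev w). length bs \<le> q"
    using even_splits_generic[OF w even_splits_rev] n by auto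
  have "expected_sig_coeff P B M T w \<le> (T / M) ^ n * 2 ^ (2 * n) * (real M + 1) ^ q"
    using expected_sig_coeff_eq_block_sum[OF assms(2,3) w'(1)]
      block_sum_le[of "rev w" d "T / M" q M] splits w' assms by (simp add: even_word_def)
  also have "\<dots> \<le> (T / M) ^ n * 2 ^ (2 * n) * (2 * real M) ^ q"
    using assms by (intro mult_left_mono power_mono) auto
  also have "\<dots> = 2 ^ (2 * n) * 2 ^ q * T ^ n / (real M)\<^sup>2"
    using assms by (simp add: n power_divide power_mult_distrib power_add field_simps power2_eq_square)
  also have "\<dots> \<le> 8 ^ n * T ^ n / (real M)\<^sup>2"
  proof -
    have "(2::real) ^ (2 * n) * 2 ^ q \<le> 2 ^ (2 * n) * 2 ^ n" using n by simp
    also have "\<dots> = 8 ^ n" by (simp add: power_mult flip: power_mult_distrib)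
    finally show ?thesis using assms by (intro divide_right_mono mult_right_mono) auto
  qed
  finally show ?thesis .
qed

end

section \<open>The bound on the sum\<close>

theorem mainTheorem2:
  fixes d n :: nat
  assumes "d \<ge> 2"
  shows "\<exists>C::real. \<forall>T>0. \<forall>\<^sub>F M in sequentially.
           \<forall>(P :: 'w measure) B. brownian_motion P d B \<longrightarrow>
             (\<Sum>w \<in> K_words d n - (S_words d n \<union> W_words d n). expected_sig_coeff P B M T w)
               < C * T ^ n / (real M)\<^sup>2"
proof -
  let ?A = "K_words d n - (S_words d n \<union> W_words d n)"
  \<comment> \<open>Adding 1 makes the inequality strict, also when the sum is empty.\<close>
  let ?C = "real (card ?A) * 8 ^ n + 1"
  have "(\<Sum>w \<in> ?A. expected_sig_coeff P B M T w) < ?C * T ^ n / (real M)\<^sup>2"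
    if "0 < T" "0 < M" and B: "brownian_motion P d B" for T :: real and M and P :: "'w measure" and B
  proof -
    have "(\<Sum>w \<in> ?A. expected_sig_coeff P B M T w) \<le> (\<Sum>w \<in> ?A. 8 ^ n * T ^ n / (real M)\<^sup>2)"
      by (intro sum_mono brownian_motion.expected_sig_coeff_le[OF B] that)
    also have "\<dots> < ?C * T ^ n / (real M)\<^sup>2"
      using that by (simp add: field_simps)
    finally show ?thesis .
  qed
  then have "\<forall>T>0. \<forall>\<^sub>F M in sequentially. \<forall>(P :: 'w measure) B. brownian_motion P d B \<longrightarrow>
      (\<Sum>w \<in> ?A. expected_sig_coeff P B M T w) < ?C * T ^ n / (real M)\<^sup>2"
    by (intro allI impI eventually_mono[OF eventually_gt_at_top[of 0]]) simp
  then show ?thesis by blast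
qed

end
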